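(* Let $\mathcal{F}$ be a nonempty subtree-closed family of trees. Then membership in $\mathcal{R}(\mathcal{F})$ can be decided by the greedy algorithm if and only if $\mathcal{F}=\mathcal{S}_n$ for some $n\in\{0,1,2,\ldots\}\cup\{\infty\}$.
   Context: A $2$-complex is a finite simplicial complex of dimension at most $2$. For a vertex $v$ of a $2$-complex $K$, the link $\mathrm{lk}_K(v)$ is the subcomplex of faces $\tau\in K$ with $v\notin\tau$ and $\tau\cup\{v\}\in K$ (a graph); $K\setminus v$ is the subcomplex of faces not containing $v$. For a family $\mathcal{F}$ of graphs, a vertex $v$ of $K$ is initial (with respect to $\mathcal{F}$) if $\mathrm{lk}_K(v)$ is isomorphic to a graph in $\mathcal{F}$; $K$ is $\mathcal{F}$-reducible if either $K$ is the one-point complex or $K$ has an initial vertex $v$ with $K\setminus v$ $\mathcal{F}$-reducible. $\mathcal{R}(\mathcal{F})$ is the family of all $\mathcal{F}$-reducible $2$-complexes. A family of trees is subtree-closed if together with each tree it contains all its subtrees (connected subgraphs). A star is a tree of diameter at most two; $\mathcal{S}_n$ denotes the family of stars with at most $n$ leaves, i.e. the one-vertex tree, the one-edge tree, and the stars $K_{1,k}$ for $2\le k\le n$ (with $\mathcal{S}_\infty$ the family of all stars). The greedy algorithm, on input $K$, repeatedly removes an arbitrarily chosen initial vertex from the current complex as long as the current complex has more than one vertex and has an initial vertex, and accepts iff it ends with the one-point complex. Membership in $\mathcal{R}(\mathcal{F})$ can be decided by the greedy algorithm if, for every $2$-complex $K$ and every possible sequence of arbitrary choices, the algorithm accepts exactly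 when $K\in\mathcal{R}(\mathcal{F})$. *)

theory Defs
  imports "HOL-Library.Extended_Nat" "HOL-Library.Infinite_Typeclass"
begin

text \<open>
  A complex is the set of its nonempty faces; the empty face is left out. In particular the
  link of an isolated vertex is the empty set, which is not a tree.
\<close>

type_synonym 'v scomplex = "'v set set"

definition simplicial_complex :: "'v scomplex \<Rightarrow> bool" where
  "simplicial_complex K \<longleftrightarrow>
     finite K \<and> (\<forall>s\<in>K. finite s \<and> s \<noteq> {}) \<and> (\<forall>s\<in>K. \<forall>t. t \<subseteq> s \<and> t \<noteq> {} \<longrightarrow> t \<in> K)"

definition vertices :: "'v scomplex \<Rightarrow> 'v set" where
  "vertices K = {v. {v} \<in> K}"

definition two_complex :: "'v scomplex \<Rightarrow> bool" where
  "two_complex K \<longleftrightarrow> simplicial_complex K \<and> (\<forall>s\<in>K. card s \<le> 3)"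

definition link :: "'v scomplex \<Rightarrow> 'v \<Rightarrow> 'v scomplex" where
  "link K v = {t \<in> K. v \<notin> t \<and> insert v t \<in> K}"

definition deletion :: "'v scomplex \<Rightarrow> 'v \<Rightarrow> 'v scomplex" where
  "deletion K v = {t \<in> K. v \<notin> t}"

definition one_point :: "'v scomplex \<Rightarrow> bool" where
  "one_point K \<longleftrightarrow> (\<exists>v. K = {{v}})"

definition isomorphic :: "'v scomplex \<Rightarrow> 'w scomplex \<Rightarrow> bool" where
  "isomorphic K L \<longleftrightarrow> (\<exists>f. bij_betw f (vertices K) (vertices L) \<and> (\<lambda>s. f ` s) ` K = L)"


text \<open>Finite simple graphs are the complexes of dimension at most one.\<close>

definition graph :: "'v scomplex \<Rightarrow> bool" where
  "graph G \<longleftrightarrow> simplicial_complex G \<and> (\<forall>s\<in>G. card s \<le> 2)"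

definition adj :: "'v scomplex \<Rightarrow> ('v \<times> 'v) set" where
  "adj G = {(u, w). u \<noteq> w \<and> {u, w} \<in> G}"

definition connected_graph :: "'v scomplex \<Rightarrow> bool" where
  "connected_graph G \<longleftrightarrow>
     graph G \<and> vertices G \<noteq> {} \<and> (\<forall>u\<in>vertices G. \<forall>w\<in>vertices G. (u, w) \<in> (adj G)\<^sup>*)"

definition is_cycle :: "'v scomplex \<Rightarrow> 'v list \<Rightarrow> bool" where
  "is_cycle G vs \<longleftrightarrow> length vs \<ge> 3 \<and> distinct vs \<and>
     (\<forall>i<length vs. (vs ! i, vs ! (Suc i mod length vs)) \<in> adj G)"

definition tree :: "'v scomplex \<Rightarrow> bool" where
  "tree G \<longleftrightarrow> connected_graph G \<and> \<not> (\<exists>vs. is_cycle G vs)"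


text \<open>
  A family of graphs is a set of graphs whose members matter only up to isomorphism; it need
  not be closed under isomorphism.
\<close>

definition in_family :: "'v scomplex \<Rightarrow> 'w scomplex set \<Rightarrow> bool" where
  "in_family G F \<longleftrightarrow> (\<exists>H\<in>F. isomorphic G H)"

definition same_family :: "'v scomplex set \<Rightarrow> 'v scomplex set \<Rightarrow> bool" where
  "same_family F F' \<longleftrightarrow> (\<forall>G\<in>F. in_family G F') \<and> (\<forall>G\<in>F'. in_family G F)"

definition subtree_closed :: "'v scomplex set \<Rightarrow> bool" where
  "subtree_closed F \<longleftrightarrow> (\<forall>T\<in>F. \<forall>S. S \<subseteq> T \<and> connected_graph S \<longrightarrow> in_family S F)"

text \<open>
  For \<open>card L = k\<close> this is the star \<open>K\<^bsub>1,k\<^esub>\<close>, which is counted as having \<open>k\<close> leaves also for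
  \<open>k = 0\<close> (one vertex) and \<open>k = 1\<close> (one edge).
\<close>

definition star_graph :: "'v \<Rightarrow> 'v set \<Rightarrow> 'v scomplex" where
  "star_graph c L = {{c}} \<union> {{l} | l. l \<in> L} \<union> {{c, l} | l. l \<in> L}"

definition stars :: "enat \<Rightarrow> 'v scomplex set" where
  "stars n = {star_graph c L | c L. finite L \<and> c \<notin> L \<and> enat (card L) \<le> n}"


definition initial :: "'v scomplex set \<Rightarrow> 'v scomplex \<Rightarrow> 'v \<Rightarrow> bool" where
  "initial F K v \<longleftrightarrow> v \<in> vertices K \<and> in_family (link K v) F"

inductive reducible :: "'v scomplex set \<Rightarrow> 'v scomplex \<Rightarrow> bool" for F where
  point: "one_point K \<Longrightarrow> reducible F K"
| remove: "initial F K v \<Longrightarrow> reducible F (deletion K v) \<Longrightarrow> reducible F K"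

definition reducible_complexes :: "'v scomplex set \<Rightarrow> 'v scomplex set" where
  "reducible_complexes F = {K. two_complex K \<and> reducible F K}"

definition greedy_step :: "'v scomplex set \<Rightarrow> 'v scomplex \<Rightarrow> 'v scomplex \<Rightarrow> bool" where
  "greedy_step F K K' \<longleftrightarrow>
     card (vertices K) > 1 \<and> (\<exists>v. initial F K v \<and> K' = deletion K v)"

text \<open>
  Every step removes a vertex, so on a finite complex each sequence of choices reaches some
  final complex.
\<close>

definition greedy_result :: "'v scomplex set \<Rightarrow> 'v scomplex \<Rightarrow> 'v scomplex \<Rightarrow> bool" where
  "greedy_result F K L \<longleftrightarrow> (greedy_step F)\<^sup>*\<^sup>* K L \<and> \<not> (\<exists>L'. greedy_step F L L')"

definition greedy_decides :: "'v scomplex set \<Rightarrow> bool" where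
  "greedy_decides F \<longleftrightarrow>
     (\<forall>K L. two_complex K \<and> greedy_result F K L \<longrightarrow>
        (one_point L \<longleftrightarrow> K \<in> reducible_complexes F))"


lemma star_graph_mem:
  "s \<in> star_graph c L \<longleftrightarrow> s = {c} \<or> (\<exists>l\<in>L. s = {l} \<or> s = {c, l})"
  by (auto simp: star_graph_def)

lemma vertices_star_graph: "vertices (star_graph c L) = insert c L"
  by (auto simp: vertices_def star_graph_mem)

lemma adj_star_graph:
  assumes "c \<notin> L"
  shows "(u, w) \<in> adj (star_graph c L) \<longleftrightarrow> u = c \<and> w \<in> L \<or> w = c \<and> u \<in> L"
  using assms by (auto simp: adj_def star_graph_mem doubleton_eq_iff)

lemma star_graph_distance:
  assumes "c \<notin> L" "u \<in> insert c L" "w \<in> insert c L"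
  shows "\<exists>k\<le>2. (u, w) \<in> adj (star_graph c L) ^^ k"
proof -
  let ?A = "adj (star_graph c L)"
  consider "u = w" | "(u, w) \<in> ?A" | "(u, c) \<in> ?A" "(c, w) \<in> ?A"
    using assms by (auto simp: adj_star_graph)
  then show ?thesis
  proof cases
    case 1
    then have "(u, w) \<in> ?A ^^ 0" by simp
    then show ?thesis by blast
  next
    case 2
    then have "(u, w) \<in> ?A ^^ 1" by simp
    then show ?thesis using one_le_numeral by blast
  next
    case 3
    then have "(u, w) \<in> ?A ^^ 2" by (auto simp: numeral_2_eq_2)
    then show ?thesis by blast
  qed
qed

lemma simplicial_complex_star_graph:
  assumes "finite L"
  shows "simplicial_complex (star_graph c L)"
proof -
  have "star_graph c L \<subseteq> Pow (insert c L)"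
    by (auto simp: star_graph_mem)
  then have "finite (star_graph c L)"
    using assms by (meson finite_Pow_iff finite_insert finite_subset)
  moreover have "t \<in> star_graph c L" if "s \<in> star_graph c L" "t \<subseteq> s" "t \<noteq> {}" for s t
  proof -
    have "s = {c} \<or> (\<exists>l\<in>L. s \<subseteq> {c, l})"
      using that(1) by (auto simp: star_graph_mem)
    then have "t = {c} \<or> (\<exists>l\<in>L. t \<subseteq> {c, l})"
      using that by blast
    then consider "t = {c}" | l where "l \<in> L" "t \<subseteq> {c, l}"
      by blast
    then show ?thesis
    proof cases
      case 1
      then show ?thesis by (simp add: star_graph_mem)
    next
      case 2
      then have "t = {c} \<or> t = {l} \<or> t = {c, l}" using that(3) by blast
      then show ?thesis using 2 by (auto simp: star_graph_mem)
    qed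
  qed
  ultimately show ?thesis
    unfolding simplicial_complex_def by (auto simp: star_graph_mem)
qed

lemma tree_star_graph:
  assumes "finite L" "c \<notin> L"
  shows "tree (star_graph c L)"
proof -
  let ?G = "star_graph c L"
  have "graph ?G"
    using simplicial_complex_star_graph[OF assms(1)]
    by (auto simp: graph_def star_graph_mem card_insert_if)
  moreover have "(u, w) \<in> (adj ?G)\<^sup>*" if "u \<in> vertices ?G" "w \<in> vertices ?G" for u w
    using star_graph_distance[OF assms(2)] that relpow_imp_rtrancl
    unfolding vertices_star_graph by blast
  moreover have "\<not> is_cycle ?G vs" for vs
  proof
    assume "is_cycle ?G vs"
    then have len: "length vs \<ge> 3" and d: "distinct vs"
      and e: "\<And>i. i < length vs \<Longrightarrow> (vs ! i, vs ! (Suc i mod length vs)) \<in> adj ?G"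
      by (auto simp: is_cycle_def)
    have "0 < length vs" using len by linarith
    then have e0: "(vs ! 0, vs ! 1) \<in> adj ?G"
      using e[of 0] len by simp
    have e1: "(vs ! 1, vs ! 2) \<in> adj ?G"
      using e[of 1] len by (simp add: numeral_2_eq_2)
    have ne: "vs ! 0 \<noteq> vs ! 2" "vs ! 1 \<noteq> vs ! 2"
    proof -
      have "0 < length vs" "1 < length vs" "2 < length vs" using len by linarith+
      then show "vs ! 0 \<noteq> vs ! 2" "vs ! 1 \<noteq> vs ! 2"
        using d by (simp_all add: nth_eq_iff_index_eq)
    qed
    have c1: "vs ! 1 = c"
      using e0 e1 ne assms(2) by (auto simp: adj_star_graph)
    have "(vs ! 2, vs ! (3 mod length vs)) \<in> adj ?G"
      using e[of 2] len by (simp add: numeral_3_eq_3 numeral_2_eq_2)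
    then have "vs ! (3 mod length vs) = vs ! 1"
      using c1 ne assms(2) by (auto simp: adj_star_graph)
    moreover have "1 < length vs" using len by linarith
    moreover have "3 mod length vs < length vs" using len by (intro mod_less_divisor) linarith
    moreover have "3 mod length vs \<noteq> 1" using len by (cases "length vs = 3") auto
    ultimately show False
      using d by (simp add: nth_eq_iff_index_eq)
  qed
  ultimately show ?thesis
    by (auto simp: tree_def connected_graph_def vertices_star_graph)
qed

lemma no_short_cycles:
  assumes "tree T" "distinct vs" "length vs \<ge> 3"
    and "successively (\<lambda>u w. (u, w) \<in> adj T) vs"
    and "(last vs, hd vs) \<in> adj T"
  shows False
proof -
  have "(vs ! i, vs ! (Suc i mod length vs)) \<in> adj T" if "i < length vs" for i
  proof (cases "Suc i < length vs")
    case True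
    then show ?thesis using assms(4) by (simp add: successively_conv_nth)
  next
    case False
    then have "Suc i = length vs" using that by simp
    then have "i = length vs - 1" "vs \<noteq> []" by auto
    then show ?thesis using assms(5) \<open>Suc i = length vs\<close>
      by (simp add: last_conv_nth hd_conv_nth)
  qed
  then have "is_cycle T vs" using assms(2,3) by (simp add: is_cycle_def)
  then show False using assms(1) by (auto simp: tree_def)
qed

lemma stars_infinity:
  "stars \<infinity> = {T :: 'v scomplex. tree T \<and>
     (\<forall>u\<in>vertices T. \<forall>w\<in>vertices T. \<exists>k\<le>2. (u, w) \<in> adj T ^^ k)}" (is "_ = ?R")
proof (rule set_eqI, rule iffI)
  fix T :: "'v scomplex"
  assume "T \<in> stars \<infinity>"
  then obtain c L where "T = star_graph c L" "finite L" "c \<notin> L"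
    by (auto simp: stars_def)
  then show "T \<in> ?R"
    using tree_star_graph star_graph_distance[of c L] by (auto simp: vertices_star_graph)
next
  fix T :: "'v scomplex"
  assume "T \<in> ?R"
  then have t: "tree T"
    and dist: "\<And>u w. u \<in> vertices T \<Longrightarrow> w \<in> vertices T \<Longrightarrow> \<exists>k\<le>2. (u, w) \<in> adj T ^^ k"
    by auto
  have sc: "simplicial_complex T" and dim: "\<And>s. s \<in> T \<Longrightarrow> card s \<le> 2" and ne: "vertices T \<noteq> {}"
    using t by (auto simp: tree_def connected_graph_def graph_def)
  have sym: "(w, u) \<in> adj T" if "(u, w) \<in> adj T" for u w
    using that by (auto simp: adj_def insert_commute)
  have irr: "u \<noteq> w" if "(u, w) \<in> adj T" for u w
    using that by (auto simp: adj_def)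
  have vert: "v \<in> vertices T" if "v \<in> s" "s \<in> T" for v s
  proof -
    have "\<forall>s\<in>T. \<forall>t. t \<subseteq> s \<and> t \<noteq> {} \<longrightarrow> t \<in> T"
      using sc unfolding simplicial_complex_def by (elim conjE)
    then have "{v} \<subseteq> s \<and> {v} \<noteq> {} \<longrightarrow> {v} \<in> T"
      using that(2) by metis
    then show ?thesis using that(1) by (simp add: vertices_def)
  qed
  have adjv: "u \<in> vertices T" if "(u, w) \<in> adj T" for u w
    using that vert[of u "{u, w}"] by (auto simp: adj_def)
  have c3: False if "(x, y) \<in> adj T" "(y, z) \<in> adj T" "(z, x) \<in> adj T" for x y z
    using no_short_cycles[OF t, of "[x, y, z]"] that
      irr[of x y] irr[of y z] irr[of z x]
    by auto
  have c4: False if "(x, y) \<in> adj T" "(y, z) \<in> adj T" "(z, w) \<in> adj T" "(w, x) \<in> adj T"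
    "x \<noteq> z" "y \<noteq> w" for x y z w
    using no_short_cycles[OF t, of "[x, y, z, w]"] that
      irr[of x y] irr[of y z] irr[of z w] irr[of w x]
    by auto
  have c5: False if "(x, y) \<in> adj T" "(y, z) \<in> adj T" "(z, w) \<in> adj T" "(w, v) \<in> adj T"
    "(v, x) \<in> adj T" "x \<noteq> z" "x \<noteq> w" "y \<noteq> w" "y \<noteq> v" "z \<noteq> v" for x y z w v
    using no_short_cycles[OF t, of "[x, y, z, w, v]"] that
      irr[of x y] irr[of y z] irr[of z w] irr[of w v] irr[of v x]
    by auto
  have near: "u = w \<or> (u, w) \<in> adj T \<or> (\<exists>m. (u, m) \<in> adj T \<and> (m, w) \<in> adj T)"
    if uw: "u \<in> vertices T" "w \<in> vertices T" for u w
  proof -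
    obtain k where "k \<le> 2" "(u, w) \<in> adj T ^^ k" using dist[OF uw] by blast
    moreover from this have "k = 0 \<or> k = 1 \<or> k = 2" by auto
    ultimately show ?thesis by (auto simp: numeral_2_eq_2)
  qed
  obtain c where c: "c \<in> vertices T"
    and cmax: "(\<exists>x y. x \<noteq> y \<and> (c, x) \<in> adj T \<and> (c, y) \<in> adj T) \<or>
      (\<forall>m x y. (m, x) \<in> adj T \<longrightarrow> (m, y) \<in> adj T \<longrightarrow> x = y)"
  proof (cases "\<exists>m x y. (m, x) \<in> adj T \<and> (m, y) \<in> adj T \<and> x \<noteq> y")
    case True
    then obtain m x y where "(m, x) \<in> adj T" "(m, y) \<in> adj T" "x \<noteq> y" by blast
    then show ?thesis using adjv[of m x] by (intro that[of m]) blast+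
  next
    case False
    obtain c where "c \<in> vertices T" using ne by blast
    then show ?thesis using False by (intro that[of c]) blast+
  qed
  define L where "L = vertices T - {c}"
  have cL: "(c, l) \<in> adj T" if "l \<in> L" for l
  proof (rule ccontr)
    assume n: "(c, l) \<notin> adj T"
    have l: "l \<in> vertices T" "l \<noteq> c" using that by (auto simp: L_def)
    obtain m where m: "(c, m) \<in> adj T" "(m, l) \<in> adj T"
      using near[OF c l(1)] n l by blast
    obtain x where x: "x \<noteq> m" "(c, x) \<in> adj T"
    proof -
      have "\<exists>x y. x \<noteq> y \<and> (c, x) \<in> adj T \<and> (c, y) \<in> adj T"
        using cmax sym[OF m(1)] m(2) l(2) by blast
      then show ?thesis using that by metis
    qed
    note rev_adj = sym[OF m(1)] sym[OF m(2)] sym[OF x(2)]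
    have xv: "x \<in> vertices T" using adjv rev_adj(3) .
    consider "(x, l) \<in> adj T" | y where "(x, y) \<in> adj T" "(y, l) \<in> adj T"
      using near[OF xv l(1)] x(2) n by blast
    then show False
    proof cases
      case 1
      from c4[OF x(2) this rev_adj(2,1)] show ?thesis using x(1) l(2) by blast
    next
      case 2
      have y: "y \<noteq> c" using 2(2) n by blast
      have "y \<noteq> m" using c3[OF x(2) _ rev_adj(1)] 2(1) by blast
      moreover have "x \<noteq> l" using x(2) n by blast
      ultimately show ?thesis
        using c5[OF x(2) 2 rev_adj(2,1)] x(1) y l(2) by blast
    qed
  qed
  have "T = star_graph c L"
  proof (rule set_eqI, rule iffI)
    fix s assume s: "s \<in> T"
    have "finite s \<and> s \<noteq> {}"
      using sc s unfolding simplicial_complex_def by (elim conjE bspec)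
    moreover have "card s \<le> 2" using dim s .
    ultimately have "card s = 1 \<or> card s = 2"
      using card_gt_0_iff[of s] by linarith
    then consider a where "s = {a}" | a b where "s = {a, b}" "a \<noteq> b"
      by (auto simp: card_1_singleton_iff card_2_iff)
    then show "s \<in> star_graph c L"
    proof cases
      case 1
      then show ?thesis using s by (auto simp: star_graph_mem L_def vertices_def)
    next
      case 2
      then have ab: "(a, b) \<in> adj T" using s by (auto simp: adj_def)
      have "a = c \<or> b = c"
        using c3[of c a b] cL[of a] sym[OF cL[of b]] ab adjv[OF ab] adjv[OF sym[OF ab]]
        by (auto simp: L_def)
      then show ?thesis
        using 2 adjv[OF ab] adjv[OF sym[OF ab]]
        by (auto simp: star_graph_mem L_def insert_commute)
    qed
  next
    fix s assume "s \<in> star_graph c L"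
    then show "s \<in> T"
      using c cL by (auto simp: star_graph_mem L_def vertices_def adj_def)
  qed
  moreover have "finite L"
  proof -
    have "(\<lambda>v. {v}) ` vertices T \<subseteq> T" by (auto simp: vertices_def)
    then have "finite ((\<lambda>v. {v}) ` vertices T)"
      using sc finite_subset unfolding simplicial_complex_def by (elim conjE)
    then show ?thesis unfolding L_def
      by (simp add: finite_image_iff)
  qed
  ultimately show "T \<in> stars \<infinity>" by (auto simp: stars_def L_def)
qed

end

(*
  If F is a family of stars S_n, removals can be exchanged: for two initial vertices u and v of a
  complex, either removing one keeps the other initial, or transposing u and v is an automorphism.
  Hence removing an initial vertex preserves reducibility, and the greedy algorithm never fails.

  A subtree-closed family of stars is some S_n. Any other subtree-closed family contains all paths
  on at most four vertices, and an explicit complex on 19 vertices defeats the greedy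
  algorithm: it can be reduced by removing vertices whose links are such short paths, but two bad
  removals of this kind lead to a complex in which every link has a cycle or is disconnected.
*)

theory Submission
  imports Defs
begin

section \<open>Complexes and isomorphisms\<close>

lemma simplicial_complex_subface:
  "simplicial_complex K \<Longrightarrow> s \<in> K \<Longrightarrow> t \<subseteq> s \<Longrightarrow> t \<noteq> {} \<Longrightarrow> t \<in> K"
  unfolding simplicial_complex_def by blast

lemma simplicial_complex_nonempty: "simplicial_complex K \<Longrightarrow> s \<in> K \<Longrightarrow> s \<noteq> {}"
  unfolding simplicial_complex_def by blast

lemma simplicial_complex_finite: "simplicial_complex K \<Longrightarrow> finite K"
  unfolding simplicial_complex_def by blast

lemma simplicial_complex_finite_face: "simplicial_complex K \<Longrightarrow> s \<in> K \<Longrightarrow> finite s"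
  unfolding simplicial_complex_def by blast

lemma face_subset_vertices: "simplicial_complex K \<Longrightarrow> s \<in> K \<Longrightarrow> s \<subseteq> vertices K"
  using simplicial_complex_subface[of K s] by (auto simp: vertices_def)

lemma finite_vertices:
  assumes "simplicial_complex K"
  shows "finite (vertices K)"
proof -
  have "(\<lambda>v. {v}) ` vertices K \<subseteq> K" by (auto simp: vertices_def)
  then have "finite ((\<lambda>v. {v}) ` vertices K)"
    using simplicial_complex_finite[OF assms] by (rule finite_subset)
  then show ?thesis by (simp add: finite_image_iff)
qed

lemma simplicial_complex_link:
  assumes "simplicial_complex K"
  shows "simplicial_complex (link K v)"
proof -
  have "t \<in> link K v" if "s \<in> link K v" "t \<subseteq> s" "t \<noteq> {}" for s t
    using that simplicial_complex_subface[OF assms, of s t]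
      simplicial_complex_subface[OF assms, of "insert v s" "insert v t"]
    by (auto simp: link_def)
  moreover have "finite (link K v)"
    using simplicial_complex_finite[OF assms] by (simp add: link_def)
  moreover have "finite s \<and> s \<noteq> {}" if "s \<in> link K v" for s
    using that simplicial_complex_finite_face[OF assms] simplicial_complex_nonempty[OF assms]
    by (auto simp: link_def)
  ultimately show ?thesis unfolding simplicial_complex_def by blast
qed

lemma two_complex_deletion:
  assumes "two_complex K"
  shows "two_complex (deletion K v)"
  using assms unfolding two_complex_def simplicial_complex_def deletion_def by auto

lemma isomorphic_refl: "isomorphic G G"
  unfolding isomorphic_def by (rule exI[of _ id]) auto

lemma isomorphic_trans:
  assumes "isomorphic G H" "isomorphic H L"
  shows "isomorphic G L"
proof -
  obtain f g where "bij_betw f (vertices G) (vertices H)" "(\<lambda>s. f ` s) ` G = H"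
    "bij_betw g (vertices H) (vertices L)" "(\<lambda>s. g ` s) ` H = L"
    using assms unfolding isomorphic_def by blast
  then have "bij_betw (g \<circ> f) (vertices G) (vertices L)" "(\<lambda>s. (g \<circ> f) ` s) ` G = L"
    by (auto intro: bij_betw_trans simp: image_comp[symmetric])
  then show ?thesis unfolding isomorphic_def by blast
qed

text \<open>The inverse is \<open>inv_into\<close> on the vertex set. It restores each face because
  the faces of a complex consist of vertices.\<close>

lemma isomorphic_sym:
  assumes "simplicial_complex G" "isomorphic G H"
  shows "isomorphic H G"
proof -
  obtain f where f: "bij_betw f (vertices G) (vertices H)" "(\<lambda>s. f ` s) ` G = H"
    using assms(2) unfolding isomorphic_def by blast
  let ?g = "inv_into (vertices G) f"
  have "?g ` f ` s = s" if "s \<in> G" for s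
    using f(1) face_subset_vertices[OF assms(1) that] inv_into_image_cancel
    by (auto simp: bij_betw_def)
  then have "(\<lambda>s. ?g ` s) ` H = G"
    unfolding f(2)[symmetric] image_image by simp
  then show ?thesis
    using bij_betw_inv_into[OF f(1)] unfolding isomorphic_def by blast
qed

section \<open>Relabelling vertices along an injection\<close>

lemma vertices_image:
  assumes "simplicial_complex K"
  shows "vertices ((\<lambda>s. g ` s) ` K) = g ` vertices K"
proof
  show "g ` vertices K \<subseteq> vertices ((\<lambda>s. g ` s) ` K)"
    by (auto simp: vertices_def intro: rev_image_eqI)
  show "vertices ((\<lambda>s. g ` s) ` K) \<subseteq> g ` vertices K"
  proof
    fix x assume "x \<in> vertices ((\<lambda>s. g ` s) ` K)"
    then obtain s where s: "s \<in> K" "g ` s = {x}"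
      unfolding vertices_def by auto
    then show "x \<in> g ` vertices K"
      using face_subset_vertices[OF assms s(1)] by blast
  qed
qed

lemma isomorphic_image:
  assumes "simplicial_complex K" "inj_on g (vertices K)"
  shows "isomorphic K ((\<lambda>s. g ` s) ` K)"
  using assms inj_on_imp_bij_betw[OF assms(2)]
  unfolding isomorphic_def by (intro exI[of _ g]) (simp add: vertices_image)

lemma deletion_image:
  assumes "inj g"
  shows "deletion ((\<lambda>s. g ` s) ` K) (g v) = (\<lambda>s. g ` s) ` deletion K v"
  using inj_image_mem_iff[OF assms] unfolding deletion_def by blast

lemma link_image:
  assumes "inj g"
  shows "link ((\<lambda>s. g ` s) ` K) (g v) = (\<lambda>s. g ` s) ` link K v"
proof -
  have "insert (g v) (g ` s) \<in> (\<lambda>s. g ` s) ` K \<longleftrightarrow> insert v s \<in> K" for s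
  proof -
    have "inj (\<lambda>s. g ` s)" by (simp add: inj_def inj_image_eq_iff[OF assms])
    from inj_image_mem_iff[OF this, of "insert v s" K] show ?thesis by simp
  qed
  then show ?thesis
    using inj_image_mem_iff[OF assms] unfolding link_def by blast
qed

lemma in_family_isomorphic: "isomorphic G H \<Longrightarrow> in_family H F \<Longrightarrow> in_family G F"
  unfolding in_family_def using isomorphic_trans by blast

lemma in_familyI: "G \<in> F \<Longrightarrow> in_family G F"
  unfolding in_family_def using isomorphic_refl by blast

lemma initial_image:
  fixes K :: "'v scomplex" and g :: "'v \<Rightarrow> 'v"
  assumes "inj g" "simplicial_complex K" "initial F K v"
  shows "initial F ((\<lambda>s. g ` s) ` K) (g v)"
proof -
  have "isomorphic (link K v) ((\<lambda>s. g ` s) ` link K v)"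
    using assms(1) by (intro isomorphic_image simplicial_complex_link assms(2)) (auto intro: inj_on_subset)
  then have "isomorphic ((\<lambda>s. g ` s) ` link K v) (link K v)"
    using isomorphic_sym simplicial_complex_link[OF assms(2)] by blast
  then show ?thesis
    using assms by (auto simp: initial_def link_image vertices_image dest: in_family_isomorphic)
qed

lemma simplicial_complex_deletion:
  "simplicial_complex K \<Longrightarrow> simplicial_complex (deletion K v)"
  unfolding simplicial_complex_def deletion_def by auto

text \<open>Any removal sequence can be relabelled step by step. The exchange argument for stars
  applies this to the transposition of two vertices.\<close>

lemma reducible_image:
  fixes K :: "'v scomplex" and g :: "'v \<Rightarrow> 'v"
  assumes "reducible F K" "inj g" "simplicial_complex K"
  shows "reducible F ((\<lambda>s. g ` s) ` K)"
  using assms(1,3)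
proof (induction rule: reducible.induct)
  case (point K)
  then show ?case by (auto simp: one_point_def intro!: reducible.point)
next
  case (remove K v)
  then have "reducible F (deletion ((\<lambda>s. g ` s) ` K) (g v))"
    using remove.IH[OF simplicial_complex_deletion] deletion_image[OF assms(2)] by simp
  then show ?case
    using initial_image[OF assms(2) remove.prems remove.hyps(1)] by (rule reducible.remove[rotated])
qed

section \<open>Families of stars\<close>

definition star_with :: "enat \<Rightarrow> 'v scomplex \<Rightarrow> bool" where
  "star_with n G \<longleftrightarrow>
     (\<exists>c L. G = star_graph c L \<and> finite L \<and> c \<notin> L \<and> enat (card L) \<le> n)"

lemma image_star_graph:
  fixes g :: "'a \<Rightarrow> 'b"
  shows "(\<lambda>s. g ` s) ` star_graph c L = star_graph (g c) (g ` L)"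
proof -
  have "star_graph c L = {{c}} \<union> (\<lambda>l. {l}) ` L \<union> (\<lambda>l. {c, l}) ` L" for c :: 'a and L
    by (auto simp: star_graph_def)
  moreover have "star_graph c L = {{c}} \<union> (\<lambda>l. {l}) ` L \<union> (\<lambda>l. {c, l}) ` L" for c :: 'b and L
    by (auto simp: star_graph_def)
  ultimately show ?thesis by (simp add: image_Un image_image)
qed

lemma stars_eq_star_with: "stars n = {G. star_with n G}"
  by (auto simp: stars_def star_with_def)

lemma star_with_isomorphic:
  assumes "simplicial_complex G" "isomorphic G H" "star_with n H"
  shows "star_with n G"
proof -
  obtain c L where L: "H = star_graph c L" "finite L" "c \<notin> L" "enat (card L) \<le> n"
    using assms(3) by (auto simp: star_with_def)
  obtain g where g: "bij_betw g (vertices H) (vertices G)" "(\<lambda>s. g ` s) ` H = G"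
    using isomorphic_sym[OF assms(1,2)] unfolding isomorphic_def by blast
  have "inj_on g (insert c L)"
    using g(1) L(1) by (simp add: bij_betw_def vertices_star_graph)
  then have "g c \<notin> g ` L" "card (g ` L) = card L"
    using L(3) card_image by auto
  moreover have "G = star_graph (g c) (g ` L)"
    using g(2) L(1) image_star_graph by metis
  ultimately show ?thesis using L(2,4) unfolding star_with_def
    by (intro exI[of _ "g c"] exI[of _ "g ` L"]) simp
qed

text \<open>Being a star with at most \<open>n\<close> leaves is invariant under isomorphism. So the
  condition on a link becomes a literal statement about its faces, without any isomorphism.\<close>

lemma in_family_same_stars:
  fixes F :: "'v scomplex set" and G :: "'v scomplex"
  assumes "same_family F (stars n)" "simplicial_complex G"
  shows "in_family G F \<longleftrightarrow> star_with n G"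
proof
  assume "in_family G F"
  then obtain H where "H \<in> F" "isomorphic G H" by (auto simp: in_family_def)
  moreover from this obtain S :: "'v scomplex" where "star_with n S" "isomorphic H S"
    using assms(1) by (auto simp: same_family_def in_family_def stars_eq_star_with)
  ultimately show "star_with n G"
    using star_with_isomorphic isomorphic_trans assms(2) by blast
qed (use assms(1) in \<open>auto simp: same_family_def stars_eq_star_with\<close>)

lemma star_with_remove_leaf:
  assumes "star_with n G" "{u} \<in> G" "\<exists>!w. w \<noteq> u \<and> {u, w} \<in> G"
  shows "star_with n {s \<in> G. u \<notin> s}"
proof -
  obtain c L where L: "G = star_graph c L" "finite L" "c \<notin> L" "enat (card L) \<le> n"
    using assms(1) by (auto simp: star_with_def)
  \<comment> \<open>A vertex with exactly one neighbour is a leaf for a suitable choice of centre: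
    if it is the given centre, the star is a single edge and the other end can serve as
    centre.\<close>
  have "\<exists>w M. G = star_graph w M \<and> finite M \<and> w \<notin> M \<and> enat (card M) \<le> n \<and> u \<in> M"
  proof (cases "u = c")
    case True
    obtain w where w: "w \<noteq> u" "{u, w} \<in> G" and uniq: "\<And>w'. w' \<noteq> u \<Longrightarrow> {u, w'} \<in> G \<Longrightarrow> w' = w"
      using assms(3) by blast
    have "L = {w}"
    proof (rule set_eqI, rule iffI)
      fix x assume "x \<in> L"
      then have "{u, x} \<in> G" "x \<noteq> u" unfolding L(1) True using L(3) by (auto simp: star_graph_mem)
      then have "x = w" using uniq by blast
      then show "x \<in> {w}" by simp
    next
      fix x assume "x \<in> {w}"
      then show "x \<in> L"
        using w unfolding L(1) True by (auto simp: star_graph_mem doubleton_eq_iff)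
    qed
    then have "G = star_graph w {u}" "enat (card {u}) \<le> n"
      using True \<open>L = {w}\<close> L(4) unfolding L(1) by (auto simp: star_graph_def)
    then show ?thesis using w(1) by (intro exI[of _ w] exI[of _ "{u}"]) simp
  next
    case False
    then have "u \<in> L" using assms(2) L(1) by (auto simp: star_graph_mem)
    then show ?thesis using L by (intro exI[of _ c] exI[of _ L]) simp
  qed
  then obtain w M where M: "G = star_graph w M" "finite M" "w \<notin> M" "enat (card M) \<le> n" "u \<in> M"
    by blast
  have "{s \<in> G. u \<notin> s} = star_graph w (M - {u})"
  proof (rule set_eqI)
    fix s
    show "s \<in> {s \<in> G. u \<notin> s} \<longleftrightarrow> s \<in> star_graph w (M - {u})"
      using M(3,5) unfolding M(1) by (cases "u = w") (auto simp: star_graph_mem)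
  qed
  moreover have "enat (card (M - {u})) \<le> n"
    by (rule order_trans[OF _ M(4)]) (simp add: card_Diff1_le)
  ultimately show ?thesis
    using M(2,3) unfolding star_with_def by (intro exI[of _ w] exI[of _ "M - {u}"]) simp
qed

text \<open>A leaf has the centre as its only neighbour, so \<open>u\<close> must be the centre, and
  deleting it leaves only isolated points. The one-vertex star is included, with both sides
  empty.\<close>

lemma star_with_center:
  assumes "star_with n G" "{u} \<in> G" "\<not> (\<exists>!w. w \<noteq> u \<and> {u, w} \<in> G)"
  shows "{s \<in> G. u \<notin> s} = {{w} | w. w \<noteq> u \<and> {u, w} \<in> G}"
proof -
  obtain c L where L: "G = star_graph c L" "c \<notin> L"
    using assms(1) by (auto simp: star_with_def)
  have "u = c"
  proof (rule ccontr)
    assume "u \<noteq> c"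
    then have "u \<in> L" using assms(2) L(1) by (auto simp: star_graph_mem)
    then have "\<exists>!w. w \<noteq> u \<and> {u, w} \<in> G"
      using L \<open>u \<noteq> c\<close> by (intro ex1I[of _ c]) (auto simp: star_graph_mem doubleton_eq_iff)
    then show False using assms(3) by blast
  qed
  have "{s \<in> G. u \<notin> s} = {{w} | w. w \<in> L}"
    unfolding L(1) \<open>u = c\<close> using L(2) by (auto simp: star_graph_mem)
  moreover have "w \<in> L \<longleftrightarrow> w \<noteq> u \<and> {u, w} \<in> G" for w
    unfolding L(1) \<open>u = c\<close> using L(2) by (auto simp: star_graph_mem doubleton_eq_iff)
  ultimately show ?thesis by simp
qed

section \<open>Exchanging two removals when the links are stars\<close>

lemma deletion_commute: "deletion (deletion K u) v = deletion (deletion K v) u"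
  by (auto simp: deletion_def)

lemma link_deletion: "u \<noteq> v \<Longrightarrow> link (deletion K u) v = {s \<in> link K v. u \<notin> s}"
  by (auto simp: link_def deletion_def)

lemma vertices_deletion: "vertices (deletion K u) = vertices K - {u}"
  by (auto simp: vertices_def deletion_def)

text \<open>
  If the edge \<open>uv\<close> lies in exactly one triangle, or is absent, the two removals commute. Otherwise
  \<open>u\<close> and \<open>v\<close> are the centres of each other's links, and swapping them is an automorphism.
\<close>

lemma stars_reducible_deletion:
  fixes F :: "'v scomplex set"
  assumes F: "same_family F (stars n)" and "reducible F K" "simplicial_complex K" "initial F K v"
  shows "reducible F (deletion K v)"
  using assms(2-)
proof (induction arbitrary: v rule: reducible.induct)
  case (point K)
  \<comment> \<open>A one-point complex has no initial vertex: the link is empty, and a star has at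
    least its centre. The case is vacuous.\<close>
  then have "link K v = {}" by (auto simp: one_point_def link_def)
  then have "star_with n ({} :: 'v scomplex)"
    using in_family_same_stars[OF F simplicial_complex_link[OF point.prems(1), of v]]
    point.prems(2) by (simp add: initial_def)
  then show ?case by (auto simp: star_with_def star_graph_def)
next
  case (remove K u)
  note K = \<open>simplicial_complex K\<close>
  note fam = in_family_same_stars[OF F simplicial_complex_link[OF K]]
  note famd = in_family_same_stars[OF F simplicial_complex_link[OF simplicial_complex_deletion[OF K]]]
  show ?case
  proof (cases "u = v")
    case True
    then show ?thesis using remove by simp
  next
    case False
    have sv: "star_with n (link K v)" and su: "star_with n (link K u)"
      and vert: "{v} \<in> K" "{u} \<in> K"
      using \<open>initial F K u\<close> \<open>initial F K v\<close> fam by (simp_all add: initial_def vertices_def)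
    then have vert': "v \<in> vertices K" "u \<in> vertices K" by (simp_all add: vertices_def)
    \<comment> \<open>If each vertex stays initial after removal of the other, the induction
      hypothesis for \<open>deletion K u\<close> removes \<open>v\<close>, and the two removals are
      then interchanged.\<close>
    have commute: ?thesis
      if "star_with n {s \<in> link K v. u \<notin> s}" "star_with n {s \<in> link K u. v \<notin> s}"
    proof -
      have "initial F (deletion K u) v"
        using that(1) famd[of u v] False vert' by (simp add: initial_def link_deletion vertices_deletion)
      then have "reducible F (deletion (deletion K v) u)"
        using remove.IH[OF simplicial_complex_deletion[OF K]] deletion_commute by metis
      moreover have "initial F (deletion K v) u"
        using that(2) famd[of v u] False vert' by (simp add: initial_def link_deletion vertices_deletion)
      ultimately show ?thesis by (rule reducible.remove[rotated])
    qed
    \<comment> \<open>The third vertices of triangles on \<open>u\<close> and \<open>v\<close>. They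
      are at once the neighbours of \<open>u\<close> in the link of \<open>v\<close> and those of
      \<open>v\<close> in the link of \<open>u\<close>, so both links fall into the same case
      below.\<close>
    let ?W = "\<lambda>w. w \<noteq> u \<and> w \<noteq> v \<and> {u, v, w} \<in> K"
    have Wv: "w \<noteq> u \<and> {u, w} \<in> link K v \<longleftrightarrow> ?W w" for w
    proof -
      have "insert v {u, w} = {u, v, w}" by blast
      then show ?thesis
        using False simplicial_complex_subface[OF K, of "{u, v, w}" "{u, w}"]
        by (auto simp: link_def)
    qed
    have Wu: "w \<noteq> v \<and> {v, w} \<in> link K u \<longleftrightarrow> ?W w" for w
      using False simplicial_complex_subface[OF K, of "{u, v, w}" "{v, w}"]
      by (auto simp: link_def)
    show ?thesis
    proof (cases "{u, v} \<in> K")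
      case nonadj: False
      have "{s \<in> link K v. u \<notin> s} = link K v" "{s \<in> link K u. v \<notin> s} = link K u"
        using nonadj simplicial_complex_subface[OF K, of _ "{u, v}"] by (auto simp: link_def)
      then show ?thesis using commute sv su by simp
    next
      case True
      then have e: "{u} \<in> link K v" "{v} \<in> link K u"
        using False vert by (auto simp: link_def insert_commute)
      show ?thesis
      proof (cases "\<exists>!w. ?W w")
        case True
        then have "\<exists>!w. w \<noteq> u \<and> {u, w} \<in> link K v" "\<exists>!w. w \<noteq> v \<and> {v, w} \<in> link K u"
          by (simp_all only: Wu Wv)
        then show ?thesis
          using star_with_remove_leaf[OF sv e(1)] star_with_remove_leaf[OF su e(2)] commute by simp
      next
        case False
        then have ne: "\<not> (\<exists>!w. w \<noteq> u \<and> {u, w} \<in> link K v)" "\<not> (\<exists>!w. w \<noteq> v \<and> {v, w} \<in> link K u)"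
          by (simp_all only: Wu Wv not_False_eq_True)
        \<comment> \<open>Each vertex is the centre of the other's link, so what is left of either
          link is the same set of isolated points, those satisfying \<open>?W\<close>.\<close>
        have links: "{s \<in> link K v. u \<notin> s} = {s \<in> link K u. v \<notin> s}"
          using star_with_center[OF sv e(1) ne(1)] star_with_center[OF su e(2) ne(2)]
          by (simp only: Wu Wv)
        let ?g = "id(u := v, v := u)"
        \<comment> \<open>Faces avoiding \<open>x\<close> are sorted by whether they contain
          \<open>y\<close>. The extra \<open>{}\<close> accounts for the face \<open>{y}\<close>,
          since links omit the empty face.\<close>
        have expand: "deletion K x = {s \<in> K. x \<notin> s \<and> y \<notin> s} \<union>
            insert y ` insert {} {s \<in> link K y. x \<notin> s}"
          if xy: "x \<noteq> y" "{y} \<in> K" for x y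
        proof (rule set_eqI, rule iffI)
          fix s assume s: "s \<in> deletion K x"
          show "s \<in> {s \<in> K. x \<notin> s \<and> y \<notin> s} \<union> insert y ` insert {} {s \<in> link K y. x \<notin> s}"
          proof (cases "y \<in> s")
            case True
            then have eq: "insert y (s - {y}) = s" by blast
            then have "s - {y} \<in> insert {} {s \<in> link K y. x \<notin> s}"
              using s simplicial_complex_subface[OF K, of s "s - {y}"]
              by (auto simp: link_def deletion_def)
            then show ?thesis using eq by blast
          qed (use s in \<open>auto simp: deletion_def\<close>)
        qed (use xy in \<open>auto simp: deletion_def link_def\<close>)
        have fixed: "?g ` s = s" if "u \<notin> s" "v \<notin> s" for s
        proof -
          have "?g ` s = id ` s"
            using that by (intro image_cong) auto
          then show ?thesis by simp
        qed
        have "(\<lambda>s. ?g ` s) ` deletion K u = deletion K v"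
        proof -
          have "(\<lambda>s. ?g ` s) ` {s \<in> K. u \<notin> s \<and> v \<notin> s} = id ` {s \<in> K. v \<notin> s \<and> u \<notin> s}"
            using fixed by (intro image_cong) auto
          moreover have "?g ` insert v s = insert u s" if "s \<in> insert {} {s \<in> link K v. u \<notin> s}" for s
            using that fixed[of s] by (auto simp: link_def)
          then have "(\<lambda>s. ?g ` s) ` insert v ` insert {} {s \<in> link K v. u \<notin> s} =
              insert u ` insert {} {s \<in> link K v. u \<notin> s}"
            unfolding image_image by (rule image_cong[OF refl])
          ultimately show ?thesis
            unfolding expand[OF \<open>u \<noteq> v\<close> vert(1)] expand[OF not_sym[OF \<open>u \<noteq> v\<close>] vert(2)]
            by (simp only: image_Un image_id id_apply links)
        qed
        moreover have "inj ?g" by (auto simp: inj_def)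
        ultimately show ?thesis
          using reducible_image[OF \<open>reducible F (deletion K u)\<close> _ simplicial_complex_deletion[OF K], of ?g]
          by (simp only:)
      qed
    qed
  qed
qed

section \<open>Greedy sequences\<close>

text \<open>Soundness of the algorithm, for any family: a greedy step is a legitimate removal, so
  reducibility travels backwards along a run.\<close>

lemma greedy_steps_reducible:
  assumes "(greedy_step F)\<^sup>*\<^sup>* K L" "reducible F L"
  shows "reducible F K"
  using assms
  by (induction rule: converse_rtranclp_induct) (auto simp: greedy_step_def intro: reducible.remove)

lemma in_family_trees_nonempty:
  assumes "\<forall>T\<in>F. tree T" "in_family G F"
  shows "vertices G \<noteq> {}"
proof -
  obtain T where "T \<in> F" "isomorphic G T" using assms(2) by (auto simp: in_family_def)
  moreover have "vertices T \<noteq> {}"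
    using assms(1) \<open>T \<in> F\<close> unfolding tree_def connected_graph_def by blast
  ultimately show ?thesis by (auto simp: isomorphic_def bij_betw_def)
qed

text \<open>A tree has a vertex, so the link of an initial vertex supplies a second vertex of
  \<open>K\<close>. The size condition of a greedy step thus holds automatically.\<close>

lemma greedy_step_initial:
  assumes "\<forall>T\<in>F. tree T" "simplicial_complex K" "initial F K v"
  shows "greedy_step F K (deletion K v)"
proof -
  have "in_family (link K v) F" using assms(3) by (simp add: initial_def)
  then obtain w where "w \<in> vertices (link K v)"
    using in_family_trees_nonempty[OF assms(1)] by blast
  then have "w \<in> vertices K" "w \<noteq> v" by (auto simp: vertices_def link_def)
  then have "{v, w} \<subseteq> vertices K" "card {v, w} = 2"
    using assms(3) by (auto simp: initial_def)
  then have "card (vertices K) > 1"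
    using card_mono[OF finite_vertices[OF assms(2)], of "{v, w}"] by simp
  then show ?thesis using assms(3) by (auto simp: greedy_step_def)
qed

lemma greedy_decides_stars:
  fixes F :: "'v scomplex set"
  assumes "\<forall>T\<in>F. tree T" "same_family F (stars n)"
  shows "greedy_decides F"
  unfolding greedy_decides_def
proof (intro allI impI)
  fix K L :: "'v scomplex"
  assume KL: "two_complex K \<and> greedy_result F K L"
  then have steps: "(greedy_step F)\<^sup>*\<^sup>* K L" and stuck: "\<not> (\<exists>L'. greedy_step F L L')"
    by (auto simp: greedy_result_def)
  show "one_point L \<longleftrightarrow> K \<in> reducible_complexes F"
  proof
    assume "one_point L"
    then show "K \<in> reducible_complexes F"
      using KL greedy_steps_reducible[OF steps reducible.point] by (simp add: reducible_complexes_def)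
  next
    assume "K \<in> reducible_complexes F"
    then have "reducible F K" by (simp add: reducible_complexes_def)
    \<comment> \<open>Reducibility is an invariant of the run by the exchange lemma. A final complex
      has no initial vertex, so if it is reducible it must be a point.\<close>
    with steps have "reducible F L \<and> two_complex L"
    proof (induction rule: rtranclp_induct)
      case (step L M)
      then obtain v where "initial F L v" "M = deletion L v" by (auto simp: greedy_step_def)
      moreover have "reducible F L" "two_complex L" "simplicial_complex L"
        using step by (auto simp: two_complex_def)
      ultimately show ?case
        using stars_reducible_deletion[OF assms(2)] two_complex_deletion by simp
    qed (use KL in simp)
    then have "reducible F L" "simplicial_complex L" by (simp_all add: two_complex_def)
    then show "one_point L"
      using stuck greedy_step_initial[OF assms(1)] by (metis reducible.cases)
  qed
qed

section \<open>Complexes generated by lists of faces\<close>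

text \<open>Lists of faces make links and deletions computable, so that the explicit example can be
  checked by evaluation. Redundant or empty lists, which deletions produce, do no harm.\<close>

definition generated :: "'a list list \<Rightarrow> 'a scomplex" where
  "generated fs = {s. s \<noteq> {} \<and> (\<exists>g\<in>set fs. s \<subseteq> set g)}"

lemma simplicial_complex_generated: "simplicial_complex (generated fs)"
proof -
  have "generated fs \<subseteq> Pow (set (concat fs))" by (auto simp: generated_def)
  then have "finite (generated fs)" by (rule finite_subset) simp
  moreover have "finite s" if "s \<in> generated fs" for s
    using that finite_subset[OF _ finite_set] by (auto simp: generated_def)
  moreover have "t \<in> generated fs" if "s \<in> generated fs" "t \<subseteq> s" "t \<noteq> {}" for s t
    using that unfolding generated_def by blast
  moreover have "{} \<notin> generated fs" by (simp add: generated_def)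
  ultimately show ?thesis
    unfolding simplicial_complex_def by metis
qed

lemma generated_card_le:
  assumes "\<forall>g\<in>set fs. length g \<le> n" "s \<in> generated fs"
  shows "card s \<le> n"
proof -
  obtain g where "g \<in> set fs" "s \<subseteq> set g" using assms(2) by (auto simp: generated_def)
  then show ?thesis
    using assms(1) card_mono[of "set g" s] card_length[of g] by fastforce
qed

lemma vertices_generated: "vertices (generated fs) = set (concat fs)"
  by (auto simp: vertices_def generated_def)

lemma image_generated: "(\<lambda>s. g ` s) ` generated fs = generated (map (map g) fs)"
proof (rule set_eqI)
  fix s
  have "s \<in> generated (map (map g) fs) \<longleftrightarrow> s \<noteq> {} \<and> (\<exists>h\<in>set fs. \<exists>r\<subseteq>set h. s = g ` r)"
    by (simp add: generated_def subset_image_iff)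
  also have "\<dots> \<longleftrightarrow> s \<in> (\<lambda>s. g ` s) ` generated fs"
    by (auto simp: generated_def)
  finally show "s \<in> (\<lambda>s. g ` s) ` generated fs \<longleftrightarrow> s \<in> generated (map (map g) fs)" by blast
qed

definition link_faces :: "'a \<Rightarrow> 'a list list \<Rightarrow> 'a list list" where
  "link_faces v fs = map (removeAll v) (filter (\<lambda>g. v \<in> set g) fs)"

definition deletion_faces :: "'a \<Rightarrow> 'a list list \<Rightarrow> 'a list list" where
  "deletion_faces v fs = map (removeAll v) fs"

lemma link_generated: "link (generated fs) v = generated (link_faces v fs)"
  by (auto simp: link_def generated_def link_faces_def)

lemma deletion_generated: "deletion (generated fs) v = generated (deletion_faces v fs)"
  by (auto simp: deletion_def generated_def deletion_faces_def)

text \<open>Refinement in both directions yields equality of the generated complexes, a computable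
  test insensitive to order and redundancy.\<close>

definition refines :: "'a list list \<Rightarrow> 'a list list \<Rightarrow> bool" where
  "refines fs gs \<longleftrightarrow> (\<forall>g\<in>set fs. \<exists>h\<in>set gs. set g \<subseteq> set h)"

lemma generated_mono: "refines fs gs \<Longrightarrow> generated fs \<subseteq> generated gs"
  unfolding generated_def refines_def by blast

text \<open>The recursion ends with the singleton of the last vertex. It is redundant for longer
  paths and turns a one-element list into a one-point complex.\<close>

fun path_faces :: "'a list \<Rightarrow> 'a list list" where
  "path_faces (a # b # p) = [a, b] # path_faces (b # p)"
| "path_faces p = [p]"

lemma map_path_faces: "map (map g) (path_faces p) = path_faces (map g p)"
  by (induction p rule: path_faces.induct) auto

lemma vertices_path: "vertices (generated (path_faces p)) = set p"
  unfolding vertices_generated by (induction p rule: path_faces.induct) auto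

lemma path_connected_to_head:
  "x \<in> set p \<Longrightarrow> (hd p, x) \<in> (adj (generated (path_faces p)))\<^sup>*"
proof (induction p rule: path_faces.induct)
  case (1 a b p)
  have mono: "adj (generated (path_faces (b # p))) \<subseteq> adj (generated (path_faces (a # b # p)))"
    by (auto simp: adj_def generated_def)
  \<comment> \<open>Entries may repeat here and \<open>adj\<close> is irreflexive, so the case
    \<open>a = b\<close> relies on the reflexive closure.\<close>
  have "(a, b) \<in> (adj (generated (path_faces (a # b # p))))\<^sup>*"
    by (cases "a = b") (auto simp: adj_def generated_def)
  moreover have "(b, x) \<in> (adj (generated (path_faces (a # b # p))))\<^sup>*" if "x \<in> set (b # p)"
    using 1(1)[OF that] rtrancl_mono[OF mono] by auto
  ultimately show ?case using 1(2) by (auto intro: rtrancl_trans)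
qed auto

lemma sym_adj: "sym (adj G)"
  by (auto simp: sym_def adj_def insert_commute)

lemma connected_path:
  assumes "p \<noteq> []"
  shows "connected_graph (generated (path_faces p))"
proof -
  have "\<forall>g\<in>set (path_faces p). length g \<le> 2"
    by (induction p rule: path_faces.induct) auto
  then have "graph (generated (path_faces p))"
    using generated_card_le simplicial_complex_generated unfolding graph_def by blast
  moreover have "(x, y) \<in> (adj (generated (path_faces p)))\<^sup>*" if "x \<in> set p" "y \<in> set p" for x y
    using path_connected_to_head[OF that(1)] path_connected_to_head[OF that(2)]
      sym_rtrancl[OF sym_adj] by (metis rtrancl_trans symD)
  ultimately show ?thesis using assms unfolding connected_graph_def vertices_path by simp
qed

lemma isomorphic_paths:
  fixes p :: "'a list" and q :: "'b list"
  assumes "distinct p" "distinct q" "length p = length q"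
  shows "isomorphic (generated (path_faces p)) (generated (path_faces q))"
proof -
  \<comment> \<open>Entries at equal positions are matched.\<close>
  let ?f = "\<lambda>x. the (map_of (zip p q) x)"
  have q: "map ?f p = q"
    using assms by (intro nth_equalityI) (auto simp: map_of_zip_nth)
  then have "inj_on ?f (set p)" using assms(2) by (metis distinct_map)
  then show ?thesis
    using isomorphic_image[OF simplicial_complex_generated, of ?f "path_faces p"]
    by (simp only: vertices_path image_generated map_path_faces q)
qed

section \<open>Certified vertex removals\<close>

text \<open>What the counterexample needs of a family of trees. Length counts vertices, so the
  longest path has three edges: it is the smallest tree that is not a star.\<close>

definition short_paths :: "'v scomplex set \<Rightarrow> bool" where
  "short_paths F \<longleftrightarrow>
     (\<forall>p :: 'v list. p \<noteq> [] \<and> length p \<le> 4 \<and> distinct p \<longrightarrow> in_family (generated (path_faces p)) F)"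

definition path_link :: "'a list list \<Rightarrow> 'a \<Rightarrow> 'a list \<Rightarrow> bool" where
  "path_link fs v p \<longleftrightarrow> p \<noteq> [] \<and> length p \<le> 4 \<and> distinct p \<and>
     refines (link_faces v fs) (path_faces p) \<and> refines (path_faces p) (link_faces v fs)"

text \<open>Each removal carries its link as an explicit path, so checking a sequence needs no
  search.\<close>

fun path_removals :: "'a list list \<Rightarrow> ('a \<times> 'a list) list \<Rightarrow> bool" where
  "path_removals fs [] \<longleftrightarrow> True"
| "path_removals fs ((v, p) # ops) \<longleftrightarrow> path_link fs v p \<and> path_removals (deletion_faces v fs) ops"

definition remaining :: "'a list list \<Rightarrow> ('a \<times> 'a list) list \<Rightarrow> 'a list list" where
  "remaining fs ops = fold (\<lambda>(v, p). deletion_faces v) ops fs"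

text \<open>The link is nonempty, which already forces \<open>v\<close> to be a vertex; injectivity
  of \<open>g\<close> keeps the relabelled path free of repetitions.\<close>

lemma path_link_initial:
  fixes g :: "'a \<Rightarrow> 'v"
  assumes "inj g" "short_paths F" "path_link fs v p"
  shows "initial F (generated (map (map g) fs)) (g v)"
proof -
  have link: "link (generated fs) v = generated (path_faces p)"
    using assms(3) generated_mono unfolding link_generated path_link_def by blast
  then have "vertices (link (generated fs) v) \<noteq> {}"
    using assms(3) by (simp add: vertices_path path_link_def)
  then have "v \<in> vertices (generated fs)"
    by (auto simp: vertices_def link_def generated_def)
  moreover have "link (generated (map (map g) fs)) (g v) = generated (path_faces (map g p))"
    using link_image[OF assms(1), of "generated fs" v]
    by (simp add: image_generated link map_path_faces)
  moreover have "in_family (generated (path_faces (map g p))) F"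
    using assms inj_on_subset[OF assms(1)]
    by (simp add: short_paths_def path_link_def distinct_map)
  ultimately show ?thesis
    by (auto simp: initial_def vertices_generated)
qed

lemma path_removals_greedy:
  fixes g :: "'a \<Rightarrow> 'v"
  assumes "inj g" "short_paths F" "\<forall>T\<in>F. tree T" "path_removals fs ops"
  shows "(greedy_step F)\<^sup>*\<^sup>* (generated (map (map g) fs)) (generated (map (map g) (remaining fs ops)))"
  using assms(4)
proof (induction fs ops rule: path_removals.induct)
  case (1 fs)
  then show ?case by (simp add: remaining_def)
next
  case (2 fs v p ops)
  have "generated (map (map g) (deletion_faces v fs)) = deletion (generated (map (map g) fs)) (g v)"
    using deletion_image[OF assms(1), of "generated fs" v]
    by (simp add: deletion_generated image_generated)
  moreover have "path_link fs v p" using 2(2) by simp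
  ultimately have "greedy_step F (generated (map (map g) fs)) (generated (map (map g) (deletion_faces v fs)))"
    using greedy_step_initial[OF assms(3) simplicial_complex_generated path_link_initial[OF assms(1,2)]]
    by simp
  moreover have "remaining fs ((v, p) # ops) = remaining (deletion_faces v fs) ops"
    by (simp add: remaining_def)
  ultimately show ?case
    using 2 by (auto intro: converse_rtranclp_into_rtranclp)
qed

section \<open>Certificates that a link is not a tree\<close>

definition has_cycle :: "'a list list \<Rightarrow> 'a list \<Rightarrow> bool" where
  "has_cycle fs vs \<longleftrightarrow> length vs \<ge> 3 \<and> distinct vs \<and>
     list_all (\<lambda>(x, y). x \<noteq> y \<and> list_ex (\<lambda>h. x \<in> set h \<and> y \<in> set h) fs) (zip vs (rotate1 vs))"

definition has_isolated_vertex :: "'a list list \<Rightarrow> 'a \<Rightarrow> bool" where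
  "has_isolated_vertex fs w \<longleftrightarrow> w \<in> set (concat fs) \<and> list_ex (list_ex (\<lambda>x. x \<noteq> w)) fs \<and>
     list_all (\<lambda>h. w \<in> set h \<longrightarrow> list_all (\<lambda>x. x = w) h) fs"

lemma has_cycle_not_tree:
  assumes "has_cycle fs vs" "isomorphic (generated fs) T"
  shows "\<not> tree T"
proof -
  obtain f where f: "inj_on f (set (concat fs))" "(\<lambda>s. f ` s) ` generated fs = T"
    using assms(2) unfolding isomorphic_def bij_betw_def vertices_generated by blast
  have len: "length vs \<ge> 3" and d: "distinct vs" using assms(1) by (auto simp: has_cycle_def)
  have edge: "vs ! i \<noteq> vs ! (Suc i mod length vs)"
    "\<exists>h\<in>set fs. vs ! i \<in> set h \<and> vs ! (Suc i mod length vs) \<in> set h" if "i < length vs" for i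
    using assms(1) that
    by (auto simp: has_cycle_def list_all_length list_ex_iff nth_rotate1)
  have "set vs \<subseteq> set (concat fs)"
    using edge(2) by (fastforce simp: in_set_conv_nth)
  then have inj: "inj_on f (set vs)" using f(1) inj_on_subset by blast
  have "is_cycle T (map f vs)"
    unfolding is_cycle_def
  proof (intro conjI allI impI)
    fix i assume "i < length (map f vs)"
    then have i: "i < length vs" by simp
    have i': "Suc i mod length vs < length vs" using len by (intro mod_less_divisor) linarith
    have "{vs ! i, vs ! (Suc i mod length vs)} \<in> generated fs"
      using edge(2)[OF i] by (auto simp: generated_def)
    then have "{f (vs ! i), f (vs ! (Suc i mod length vs))} \<in> T"
      unfolding f(2)[symmetric] by (rule rev_image_eqI) simp
    moreover have "f (vs ! i) \<noteq> f (vs ! (Suc i mod length vs))"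
      using edge(1)[OF i] inj i i' by (simp add: inj_on_eq_iff)
    ultimately show "(map f vs ! i, map f vs ! (Suc i mod length (map f vs))) \<in> adj T"
      using i i' by (simp add: adj_def)
  qed (use len d inj in \<open>simp_all add: distinct_map\<close>)
  then show ?thesis by (auto simp: tree_def)
qed

lemma has_isolated_vertex_not_tree:
  assumes "has_isolated_vertex fs w" "isomorphic (generated fs) T"
  shows "\<not> tree T"
proof
  assume "tree T"
  obtain f where f: "bij_betw f (set (concat fs)) (vertices T)" "(\<lambda>s. f ` s) ` generated fs = T"
    using assms(2) unfolding isomorphic_def vertices_generated by blast
  have w: "w \<in> set (concat fs)" using assms(1) by (simp add: has_isolated_vertex_def)
  obtain x where x: "x \<in> set (concat fs)" "x \<noteq> w"
    using assms(1) by (auto simp: has_isolated_vertex_def list_ex_iff)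
  have inj: "inj_on f (set (concat fs))" using f(1) by (rule bij_betw_imp_inj_on)
  have "f w \<in> vertices T" "f x \<in> vertices T" "f w \<noteq> f x"
    using bij_betw_apply[OF f(1)] w x inj_on_eq_iff[OF inj w x(1)] by metis+
  then have "(f w, f x) \<in> (adj T)\<^sup>*" "f w \<noteq> f x"
    using \<open>tree T\<close> unfolding tree_def connected_graph_def by blast+
  \<comment> \<open>A walk between distinct vertices has a first edge. Pulled back along
    \<open>f\<close>, it gives a face with \<open>w\<close> and another vertex, against
    isolation.\<close>
  then obtain y where y: "(f w, y) \<in> adj T" by (meson converse_rtranclE)
  then obtain s where s: "s \<in> generated fs" "{f w, y} = f ` s" "f w \<noteq> y"
    unfolding adj_def f(2)[symmetric] by auto
  obtain h where h: "h \<in> set fs" "s \<subseteq> set h" using s(1) by (auto simp: generated_def)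
  have "f w \<in> f ` s" unfolding s(2)[symmetric] by simp
  then obtain v where v: "v \<in> s" "f v = f w" by (elim imageE) simp
  then have "v = w" using inj_on_eq_iff[OF inj _ w, of v] h by auto
  then have "set h \<subseteq> {w}"
    using assms(1) h v(1) by (auto simp: has_isolated_vertex_def list_all_iff)
  then have "f ` s \<subseteq> {f w}" using h(2) by blast
  then show False using s(3) unfolding s(2)[symmetric] by simp
qed

text \<open>One list serves both tests: it lists a cycle in order, or its head is an isolated
  vertex.\<close>

definition certified_non_tree :: "'a list list \<Rightarrow> 'a list \<Rightarrow> bool" where
  "certified_non_tree fs vs \<longleftrightarrow> has_cycle fs vs \<or> has_isolated_vertex fs (hd vs)"

lemma certified_not_initial:
  fixes g :: "'a \<Rightarrow> 'v"
  assumes "inj g" "\<forall>T\<in>F. tree T" "certified_non_tree (link_faces v fs) vs"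
  shows "\<not> initial F (generated (map (map g) fs)) (g v)"
proof
  assume "initial F (generated (map (map g) fs)) (g v)"
  then have "in_family (link (generated (map (map g) fs)) (g v)) F" by (simp add: initial_def)
  moreover have "link (generated (map (map g) fs)) (g v) = (\<lambda>s. g ` s) ` generated (link_faces v fs)"
    using link_image[OF assms(1), of "generated fs" v] by (simp add: image_generated link_generated)
  moreover have "isomorphic (generated (link_faces v fs)) ((\<lambda>s. g ` s) ` generated (link_faces v fs))"
    by (intro isomorphic_image simplicial_complex_generated inj_on_subset[OF assms(1)]) simp
  ultimately have "in_family (generated (link_faces v fs)) F"
    using in_family_isomorphic by metis
  then obtain T where "T \<in> F" "isomorphic (generated (link_faces v fs)) T"
    by (auto simp: in_family_def)
  then show False
    using assms(2,3) has_cycle_not_tree has_isolated_vertex_not_tree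
    unfolding certified_non_tree_def by metis
qed

section \<open>A complex on which the greedy algorithm fails\<close>

text \<open>
  Only vertex 7 of this complex has a tree as its link, namely the path 0, 6, 5. It can be reduced
  to its vertex 0, but not to 7. It was found by a computer search.
\<close>

definition rigid_faces :: "nat list list" where
  "rigid_faces =
     [[0, 1, 2], [0, 1, 3], [0, 1, 4], [0, 3, 5], [0, 4, 5], [0, 4, 6], [0, 6, 7],
      [1, 2, 3], [1, 2, 4], [1, 3, 5], [2, 3, 4], [3, 5, 6], [4, 5, 6], [5, 6, 7]]"

text \<open>
  Two copies of the rigid complex are joined through 16, 17 and 18. Once 16 is removed, the
  first copy shrinks to its vertex 0, then 17 and 18 can go and free the second copy. Once 17 and
  18 are removed, 16 joins the two copies by edges at 7 and 15 and blocks their only exits.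
\<close>

definition failing_faces :: "nat list list" where
  "failing_faces = rigid_faces @ map (map ((+) 8)) rigid_faces @
     [[0, 7, 17], [7, 16, 17], [15, 16, 18], [16, 17, 18]]"

text \<open>After 16, the first copy collapses to 0; then 0, 17 and 18 go, and the second copy
  collapses in the same order to 8, its counterpart of 0.\<close>

definition good_removals :: "(nat \<times> nat list) list" where
  "good_removals =
     [(16, [7, 17, 18, 15]), (7, [5, 6, 0, 17]), (6, [0, 4, 5, 3]), (5, [1, 3, 0, 4]),
      (4, [0, 1, 2, 3]), (3, [0, 1, 2]), (2, [0, 1]), (1, [0]), (0, [17]), (17, [18]), (18, [15]),
      (15, [8, 14, 13]), (14, [8, 12, 13, 11]), (13, [9, 11, 8, 12]), (12, [8, 9, 10, 11]),
      (11, [8, 9, 10]), (10, [8, 9]), (9, [8])]"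

definition bad_removals :: "(nat \<times> nat list) list" where
  "bad_removals = [(17, [0, 7, 16, 18]), (18, [15, 16])]"

text \<open>Most entries are cycles in the link. The exceptions are 7 and 15, whose links have 16 as
  an isolated vertex, and 16, whose link consists of the two points 7 and 15.\<close>

definition obstructions :: "(nat \<times> nat list) list" where
  "obstructions =
     [(0, [1, 3, 5, 4]), (1, [0, 2, 3]), (2, [1, 3, 4]), (3, [0, 1, 5]), (4, [0, 5, 6]),
      (5, [0, 3, 6, 4]), (6, [0, 4, 5, 7]), (7, [16]), (8, [9, 11, 13, 12]), (9, [8, 10, 11]),
      (10, [9, 11, 12]), (11, [8, 9, 13]), (12, [8, 13, 14]), (13, [8, 11, 14, 12]),
      (14, [8, 12, 13, 15]), (15, [16]), (16, [7])]"

lemma good_removals_valid: "path_removals failing_faces good_removals"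
  by code_simp

lemma good_removals_end:
  "refines (remaining failing_faces good_removals) [[8]]"
  "refines [[8]] (remaining failing_faces good_removals)"
  by code_simp+

lemma bad_removals_valid: "path_removals failing_faces bad_removals"
  by code_simp

lemma bad_removals_stuck:
  "list_all (\<lambda>h. list_all (\<lambda>v. list_ex (\<lambda>(w, vs). w = v) obstructions) h)
     (remaining failing_faces bad_removals)"
  "list_all (\<lambda>(v, vs). certified_non_tree (link_faces v (remaining failing_faces bad_removals)) vs)
     obstructions"
  by code_simp+

lemma failing_faces_dimension: "list_all (\<lambda>h. length h \<le> 3) failing_faces"
  by code_simp

text \<open>Two surviving vertices suffice to show that the stuck complex is not a point.\<close>

lemma bad_removals_end:
  "list_ex (\<lambda>h. 0 \<in> set h) (remaining failing_faces bad_removals)"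
  "list_ex (\<lambda>h. 1 \<in> set h) (remaining failing_faces bad_removals)"
  by code_simp+

lemma not_greedy_decides_short_paths:
  fixes F :: "'v::infinite scomplex set"
  assumes "short_paths F" "\<forall>T\<in>F. tree T"
  shows "\<not> greedy_decides F"
proof
  assume decides: "greedy_decides F"
  \<comment> \<open>The infinite vertex type has room for a copy of the numbered example.\<close>
  obtain g :: "nat \<Rightarrow> 'v" where g: "inj g"
    using infinite_UNIV infinite_countable_subset by blast
  let ?C = "\<lambda>fs. generated (map (map g) fs)"
  let ?K = "?C failing_faces" and ?L = "?C (remaining failing_faces bad_removals)"
  have "generated (remaining failing_faces good_removals) = generated [[8]]"
    using generated_mono[OF good_removals_end(1)] generated_mono[OF good_removals_end(2)] by blast
  then have "?C (remaining failing_faces good_removals) = (\<lambda>s. g ` s) ` generated [[8]]"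
    by (simp flip: image_generated)
  also have "generated [[8]] = {{8::nat}}" by (auto simp: generated_def)
  finally have "reducible F (?C (remaining failing_faces good_removals))"
    by (auto simp: one_point_def intro: reducible.point)
  then have "reducible F ?K"
    using greedy_steps_reducible path_removals_greedy[OF g assms good_removals_valid] by blast
  moreover have "two_complex ?K"
    unfolding two_complex_def
    using simplicial_complex_generated failing_faces_dimension generated_card_le[of "map (map g) failing_faces" 3]
    by (auto simp: list_all_iff)
  moreover have "\<not> initial F ?L w" for w
  proof
    assume init: "initial F ?L w"
    then obtain v where v: "w = g v" "v \<in> set (concat (remaining failing_faces bad_removals))"
      by (auto simp: initial_def vertices_generated)
    then obtain vs where "(v, vs) \<in> set obstructions"
      using bad_removals_stuck(1) by (fastforce simp: list_all_iff list_ex_iff)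
    then have "certified_non_tree (link_faces v (remaining failing_faces bad_removals)) vs"
      using bad_removals_stuck(2) by (auto simp: list_all_iff)
    then show False using certified_not_initial[OF g assms(2)] init v(1) by blast
  qed
  then have "greedy_result F ?K ?L"
    using path_removals_greedy[OF g assms bad_removals_valid]
    by (auto simp: greedy_result_def greedy_step_def)
  ultimately have "one_point ?L"
    using decides by (auto simp: greedy_decides_def reducible_complexes_def)
  then obtain x where "vertices ?L = {x}" by (auto simp: one_point_def vertices_def)
  moreover have "g 0 \<in> vertices ?L" "g 1 \<in> vertices ?L"
    using bad_removals_end by (auto simp: vertices_generated list_ex_iff)
  ultimately have "g 0 = g 1" by simp
  then show False using g by (simp add: inj_eq)
qed

section \<open>Families containing a tree that is not a star\<close>

text \<open>Some \<open>w\<close> lies outside the ball \<open>R\<close> of radius two around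
  \<open>a\<close>. A walk from \<open>a\<close> to \<open>w\<close> leaves \<open>R\<close> along
  an edge from \<open>c\<close> to \<open>d\<close>; then \<open>c\<close> is at distance exactly
  two, and \<open>b\<close> is a midpoint.\<close>

lemma path_in_non_star:
  assumes "tree T" "T \<notin> stars \<infinity>"
  obtains a b c d where "distinct [a, b, c, d]"
    "(a, b) \<in> adj T" "(b, c) \<in> adj T" "(c, d) \<in> adj T"
proof -
  obtain a w where aw: "a \<in> vertices T" "w \<in> vertices T" "\<not> (\<exists>k\<le>2. (a, w) \<in> adj T ^^ k)"
    using assms unfolding stars_infinity by blast
  define R where "R = {x. \<exists>k\<le>2. (a, x) \<in> adj T ^^ k}"
  have R: "x \<in> R \<longleftrightarrow> x = a \<or> (a, x) \<in> adj T \<or> (\<exists>b. (a, b) \<in> adj T \<and> (b, x) \<in> adj T)" for x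
  proof -
    have "k \<le> 2 \<longleftrightarrow> k = 0 \<or> k = 1 \<or> k = 2" for k :: nat by auto
    then have "x \<in> R \<longleftrightarrow> (a, x) \<in> adj T ^^ 0 \<or> (a, x) \<in> adj T ^^ 1 \<or> (a, x) \<in> adj T ^^ 2"
      by (simp only: R_def mem_Collect_eq conj_disj_distribR ex_disj_distrib simp_thms)
    then show ?thesis by (auto simp: numeral_2_eq_2)
  qed
  have "(a, w) \<in> (adj T)\<^sup>*"
    using assms(1) aw unfolding tree_def connected_graph_def by blast
  moreover have "w \<notin> R" using aw by (simp add: R_def)
  ultimately have "\<exists>c d. c \<in> R \<and> d \<notin> R \<and> (c, d) \<in> adj T"
    by (induction rule: rtrancl_induct) (use R in auto)
  then obtain c d where cd: "c \<in> R" "d \<notin> R" "(c, d) \<in> adj T" by blast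
  then have "c \<noteq> a" "(a, c) \<notin> adj T" using R[of d] by (metis, metis)
  then obtain b where b: "(a, b) \<in> adj T" "(b, c) \<in> adj T" using R[of c] cd(1) by blast
  have irr: "x \<noteq> y" if "(x, y) \<in> adj T" for x y using that by (auto simp: adj_def)
  have "distinct [a, b, c, d]"
    using cd b irr[OF b(1)] irr[OF b(2)] irr[OF cd(3)] R[of d] by auto
  then show thesis using that b cd(3) by blast
qed

text \<open>The prefixes of a four-vertex path in \<open>T\<close> are connected subgraphs, and any
  short path is isomorphic to the prefix of its length.\<close>

lemma short_paths_non_star:
  assumes "T \<in> F" "tree T" "T \<notin> stars \<infinity>" "subtree_closed F"
  shows "short_paths F"
  unfolding short_paths_def
proof (intro allI impI)
  fix p :: "'a list"
  assume p: "p \<noteq> [] \<and> length p \<le> 4 \<and> distinct p"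
  obtain a b c d where d: "distinct [a, b, c, d]"
    and e: "(a, b) \<in> adj T" "(b, c) \<in> adj T" "(c, d) \<in> adj T"
    using path_in_non_star[OF assms(2,3)] .
  let ?q = "take (length p) [a, b, c, d]"
  have T: "simplicial_complex T"
    using assms(2) by (simp add: tree_def connected_graph_def graph_def)
  have len: "length p = 1 \<or> length p = 2 \<or> length p = 3 \<or> length p = 4"
  proof -
    have "length p \<noteq> 0" "length p \<le> 4" using p by simp_all
    then show ?thesis by linarith
  qed
  have "refines (path_faces ?q) (path_faces [a, b, c, d])"
    using len by (auto simp: refines_def)
  then have "generated (path_faces ?q) \<subseteq> generated (path_faces [a, b, c, d])"
    by (rule generated_mono)
  also have "\<dots> \<subseteq> T"
    using e simplicial_complex_subface[OF T] by (auto simp: generated_def adj_def)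
  finally have "generated (path_faces ?q) \<subseteq> T" .
  moreover have "connected_graph (generated (path_faces ?q))"
    using p by (intro connected_path) simp
  ultimately have "in_family (generated (path_faces ?q)) F"
    using assms(1,4) unfolding subtree_closed_def by blast
  moreover have "isomorphic (generated (path_faces p)) (generated (path_faces ?q))"
    using p d len by (intro isomorphic_paths distinct_take) auto
  ultimately show "in_family (generated (path_faces p)) F"
    using in_family_isomorphic by blast
qed

section \<open>Subtree-closed families of stars\<close>

lemma isomorphic_stars:
  assumes "finite L" "finite M" "c \<notin> L" "d \<notin> M" "card L = card M"
  shows "isomorphic (star_graph c L) (star_graph d M)"
proof -
  obtain f where f: "bij_betw f L M" using assms finite_same_card_bij by blast
  let ?f = "f(c := d)"
  have "?f ` L = f ` L" using assms(3) by (intro image_cong) auto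
  then have "?f ` L = M"
    using f by (simp only: bij_betw_def)
  then have "(\<lambda>s. ?f ` s) ` star_graph c L = star_graph d M"
    by (simp only: image_star_graph fun_upd_same)
  moreover have "inj_on ?f (insert c L)"
    using f assms(3,4) by (auto simp: bij_betw_def inj_on_def)
  ultimately show ?thesis
    using isomorphic_image[OF simplicial_complex_star_graph[OF assms(1)], of ?f c]
    by (simp add: vertices_star_graph)
qed

text \<open>The bound is the supremum of the leaf numbers in \<open>F\<close>, possibly infinite;
  smaller stars are subtrees of larger ones.\<close>

lemma same_family_stars:
  fixes F :: "'v scomplex set"
  assumes "F \<noteq> {}" "subtree_closed F" "F \<subseteq> stars \<infinity>"
  shows "\<exists>n. same_family F (stars n)"
proof -
  define N where "N = {enat (card L) | c L. star_graph c L \<in> F \<and> finite L \<and> c \<notin> L}"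
  have "in_family G (stars (Sup N) :: 'v scomplex set)" if "G \<in> F" for G
  proof -
    have "G \<in> stars \<infinity>" using assms(3) that by blast
    then obtain c L where "G = star_graph c L" "finite L" "c \<notin> L"
      by (auto simp: stars_def)
    then have "G \<in> stars (Sup N)"
      using that by (auto simp: stars_def N_def intro!: Sup_upper)
    then show ?thesis by (rule in_familyI)
  qed
  moreover have "in_family G F" if "G \<in> stars (Sup N)" for G :: "'v scomplex"
    using that
  proof -
    assume "G \<in> stars (Sup N)"
    then obtain c L where G: "G = star_graph c L" "finite L" "c \<notin> L" "enat (card L) \<le> Sup N"
      by (auto simp: stars_def)
    \<comment> \<open>The supremum need not be attained. For zero leaves any member of
      \<open>F\<close> will do; for \<open>Suc k\<close> leaves, \<open>k\<close> is strictly below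
      the supremum, so some element of \<open>N\<close> exceeds \<open>k\<close>.\<close>
    have "\<exists>m\<in>N. enat (card L) \<le> m"
    proof (cases "card L")
      case 0
      obtain H where "H \<in> F" using assms(1) by blast
      moreover from this obtain d M where "H = star_graph d M" "finite M" "d \<notin> M"
        using assms(3) unfolding stars_def by blast
      ultimately have "enat (card M) \<in> N" unfolding N_def by blast
      then show ?thesis using 0 by (auto simp flip: zero_enat_def)
    next
      case (Suc k)
      then have "enat k < Sup N" using G(4) by (metis Suc_ile_eq)
      then show ?thesis using Suc by (auto simp: less_Sup_iff Suc_ile_eq)
    qed
    then obtain d M where M: "star_graph d M \<in> F" "finite M" "d \<notin> M" "card L \<le> card M"
      by (auto simp: N_def)
    obtain M' where M': "M' \<subseteq> M" "card M' = card L"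
      using obtain_subset_with_card_n[OF M(4)] by metis
    then have fin: "finite M'" "d \<notin> M'" using M finite_subset by auto
    have "star_graph d M' \<subseteq> star_graph d M" using M' by (auto simp: star_graph_def)
    moreover have "connected_graph (star_graph d M')"
      using tree_star_graph[OF fin] by (simp add: tree_def)
    ultimately have "in_family (star_graph d M') F"
      using assms(2) M(1) unfolding subtree_closed_def by blast
    moreover have "isomorphic G (star_graph d M')"
      unfolding G(1) using G fin M' by (intro isomorphic_stars) auto
    ultimately show ?thesis using in_family_isomorphic by blast
  qed
  ultimately show ?thesis unfolding same_family_def by blast
qed

theorem theorem1p5:
  fixes F :: "'v::infinite scomplex set"
  assumes "F \<noteq> {}"
    and "\<forall>T\<in>F. tree T"
    and "subtree_closed F"
  shows "greedy_decides F \<longleftrightarrow> (\<exists>n::enat. same_family F (stars n))"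
proof
  assume "greedy_decides F"
  \<comment> \<open>A member outside the stars would bring all short paths into \<open>F\<close>,
    and the explicit complex would defeat the algorithm.\<close>
  then have "F \<subseteq> stars \<infinity>"
    using short_paths_non_star not_greedy_decides_short_paths assms(2,3) by blast
  then show "\<exists>n::enat. same_family F (stars n)"
    using same_family_stars assms(1,3) by blast
next
  assume "\<exists>n::enat. same_family F (stars n)"
  then show "greedy_decides F" using greedy_decides_stars assms(2) by blast
qed

end
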